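(* Let $(Q,+)$ be a group, $\varphi,\psi\in Aut(Q,+)$, $c\in Q$, and let $(Q,A)$ be the alinear quasigroup $A(x,y)=I\varphi x+I\psi y+c$. Then the following equivalences hold: 1. $A\bot A^{(12)}$ if and only if for every $t\in Q$ the map $(\psi^{-1}\varphi-J_t\varphi^{-1}\psi)$ is a permutation of $Q$; 2. $A\bot A^{(13)}$ if and only if for every $t\in Q$ the map $(\varphi-J_{\psi t}J_c)$ is a permutation of $Q$; 3. $A\bot A^{(23)}$ if and only if for every $t\in Q$ the map $(\varepsilon+I\psi J_t)$ is a permutation of $Q$; 4. $A\bot A^{(123)}$ if and only if the map $(\psi^2-\varphi J_{\psi^{-1}c})$ is a permutation of $Q$; 5. $A\bot A^{(132)}$ if and only if the map $(\psi-\varphi^2)$ is a permutation of $Q$.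
   Context: Groups are written additively but need not be commutative. Products of maps are compositions; sums and differences of maps are pointwise in the written order: $(f+g)x=fx+gx$, $(f-g)x=fx-gx$. A permutation of $Q$ is a bijection $Q\to Q$; $\varepsilon$ is the identity map; $Ix=-x$; $J_tx=t+x-t$ for $t\in Q$. The parastrophes of a quasigroup $(Q,A)$ are the quasigroup operations defined by: $A(x_1,x_2)=x_3\Leftrightarrow A^{(12)}(x_2,x_1)=x_3\Leftrightarrow A^{(13)}(x_3,x_2)=x_1\Leftrightarrow A^{(23)}(x_1,x_3)=x_2\Leftrightarrow A^{(123)}(x_2,x_3)=x_1\Leftrightarrow A^{(132)}(x_3,x_1)=x_2$. For quasigroup operations $A,B$ on $Q$, $A\bot B$ ($A$ and $B$ are orthogonal) means that for all $a,b\in Q$ the system $A(x,y)=a$, $B(x,y)=b$ has a unique solution $(x,y)\in Q\times Q$. *)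

theory Defs
  imports Main
begin

text \<open>The class \<open>group_add\<close> is the class of additively written, not necessarily commutative
  groups; there \<open>x - y\<close> is \<open>x + (- y)\<close>, in this order.\<close>

definition quasigroup :: "('a \<Rightarrow> 'a \<Rightarrow> 'a) \<Rightarrow> bool" where
  "quasigroup A \<longleftrightarrow> (\<forall>a b. \<exists>!x. A a x = b) \<and> (\<forall>a b. \<exists>!y. A y a = b)"

definition group_automorphism :: "('a::group_add \<Rightarrow> 'a) \<Rightarrow> bool" where
  "group_automorphism f \<longleftrightarrow> bij f \<and> (\<forall>x y. f (x + y) = f x + f y)"

definition J :: "'a::group_add \<Rightarrow> 'a \<Rightarrow> 'a" where
  "J t x = t + x - t"

definition orthogonal :: "('a \<Rightarrow> 'a \<Rightarrow> 'a) \<Rightarrow> ('a \<Rightarrow> 'a \<Rightarrow> 'a) \<Rightarrow> bool" where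
  "orthogonal A B \<longleftrightarrow> (\<forall>a b. \<exists>!(x, y). A x y = a \<and> B x y = b)"

text \<open>The definite descriptions below are meaningful for quasigroup operations only; the lemmas
  \<open>par_12_iff\<close> to \<open>par_132_iff\<close> give the equivalences that define the parastrophes.\<close>

definition par_12 :: "('a \<Rightarrow> 'a \<Rightarrow> 'a) \<Rightarrow> 'a \<Rightarrow> 'a \<Rightarrow> 'a" where
  "par_12 A x2 x1 = A x1 x2"

definition par_13 :: "('a \<Rightarrow> 'a \<Rightarrow> 'a) \<Rightarrow> 'a \<Rightarrow> 'a \<Rightarrow> 'a" where
  "par_13 A x3 x2 = (THE x1. A x1 x2 = x3)"

definition par_23 :: "('a \<Rightarrow> 'a \<Rightarrow> 'a) \<Rightarrow> 'a \<Rightarrow> 'a \<Rightarrow> 'a" where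
  "par_23 A x1 x3 = (THE x2. A x1 x2 = x3)"

definition par_123 :: "('a \<Rightarrow> 'a \<Rightarrow> 'a) \<Rightarrow> 'a \<Rightarrow> 'a \<Rightarrow> 'a" where
  "par_123 A x2 x3 = (THE x1. A x1 x2 = x3)"

definition par_132 :: "('a \<Rightarrow> 'a \<Rightarrow> 'a) \<Rightarrow> 'a \<Rightarrow> 'a \<Rightarrow> 'a" where
  "par_132 A x3 x1 = (THE x2. A x1 x2 = x3)"

lemma par_12_iff: "par_12 A x2 x1 = x3 \<longleftrightarrow> A x1 x2 = x3"
  by (simp add: par_12_def)

lemma quasigroup_the_left:
  assumes "quasigroup A"
  shows "(THE x1. A x1 x2 = x3) = x1 \<longleftrightarrow> A x1 x2 = x3"
proof -
  have "\<exists>!x1. A x1 x2 = x3" using assms by (simp add: quasigroup_def)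
  then show ?thesis using theI'[of "\<lambda>x1. A x1 x2 = x3"] by blast
qed

lemma quasigroup_the_right:
  assumes "quasigroup A"
  shows "(THE x2. A x1 x2 = x3) = x2 \<longleftrightarrow> A x1 x2 = x3"
proof -
  have "\<exists>!x2. A x1 x2 = x3" using assms by (simp add: quasigroup_def)
  then show ?thesis using theI'[of "\<lambda>x2. A x1 x2 = x3"] by blast
qed

lemma par_13_iff: "quasigroup A \<Longrightarrow> par_13 A x3 x2 = x1 \<longleftrightarrow> A x1 x2 = x3"
  by (simp add: par_13_def quasigroup_the_left)

lemma par_23_iff: "quasigroup A \<Longrightarrow> par_23 A x1 x3 = x2 \<longleftrightarrow> A x1 x2 = x3"
  by (simp add: par_23_def quasigroup_the_right)

lemma par_123_iff: "quasigroup A \<Longrightarrow> par_123 A x2 x3 = x1 \<longleftrightarrow> A x1 x2 = x3"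
  by (simp add: par_123_def quasigroup_the_left)

lemma par_132_iff: "quasigroup A \<Longrightarrow> par_132 A x3 x1 = x2 \<longleftrightarrow> A x1 x2 = x3"
  by (simp add: par_132_def quasigroup_the_right)

lemma quasigroup_parastrophes:
  assumes A: "quasigroup A"
  shows "quasigroup (par_12 A)" "quasigroup (par_13 A)" "quasigroup (par_23 A)"
    "quasigroup (par_123 A)" "quasigroup (par_132 A)"
proof -
  have L: "\<exists>!x. A a x = b" and R: "\<exists>!x. A x a = b" for a b
    using A by (simp_all add: quasigroup_def)
  show "quasigroup (par_12 A)" "quasigroup (par_13 A)" "quasigroup (par_23 A)"
    "quasigroup (par_123 A)" "quasigroup (par_132 A)"
    using L R
    by (simp_all add: quasigroup_def par_12_iff par_13_iff[OF A] par_23_iff[OF A]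
        par_123_iff[OF A] par_132_iff[OF A])
qed

lemma quasigroup_alinear:
  fixes \<phi> \<psi> :: "'a::group_add \<Rightarrow> 'a"
  assumes "group_automorphism \<phi>" "group_automorphism \<psi>"
  shows "quasigroup (\<lambda>x y. - \<phi> x + - \<psi> y + c)"
proof -
  have ex: "\<exists>!x. \<phi> x = b" "\<exists>!x. \<psi> x = b" for b
    using assms by (simp_all add: group_automorphism_def bij_iff)
  have eq: "- u + - v + c = b \<longleftrightarrow> v + u + b = c" for u v b :: 'a
    by (metis minus_add minus_add_cancel add_minus_cancel)
  have "- u + - v + c = b \<longleftrightarrow> v = c - b - u" for u v b :: 'a
    unfolding eq by (simp only: eq_diff_eq)
  then have "\<exists>!y. - \<phi> a + - \<psi> y + c = b" for a b
    by (simp only: ex)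
  moreover have "- u + - v + c = b \<longleftrightarrow> u = - v + c - b" for u v b :: 'a
    unfolding eq eq_diff_eq by (metis add.assoc minus_add_cancel add_minus_cancel)
  then have "\<exists>!x. - \<phi> x + - \<psi> a + c = b" for a b
    by (simp only: ex)
  ultimately show ?thesis
    by (simp only: quasigroup_def) blast
qed

end

theory Submission
  imports Defs
begin

text \<open>If \<open>B x y = b\<close> can be solved for one of the variables, substituting the solution into \<open>A\<close>
  turns orthogonality into bijectivity of a family of maps of the other variable, indexed by \<open>b\<close>.
  For the alinear quasigroup each of these maps, after translations, inversion and a substitution
  by a bijection, becomes the map of the theorem. In parts 1 to 3 the parameter \<open>b\<close> enters through
  an arbitrary middle summand, which gives the quantifier over \<open>t\<close>; in parts 4 and 5 it is only an
  outer summand and disappears.\<close>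

lemma orthogonal_iff_bij_left:
  assumes "\<And>x y b. B x y = b \<longleftrightarrow> x = h b y"
  shows "orthogonal A B \<longleftrightarrow> (\<forall>b. bij (\<lambda>y. A (h b y) y))"
proof -
  have "(\<exists>!(x, y). A x y = a \<and> B x y = b) \<longleftrightarrow> (\<exists>!y. A (h b y) y = a)" for a b
    unfolding assms by auto
  then have "orthogonal A B \<longleftrightarrow> (\<forall>a b. \<exists>!y. A (h b y) y = a)"
    by (simp only: orthogonal_def)
  \<comment> \<open>The value \<open>a\<close> of the first equation is now the value to be hit, so
    its quantifier moves inside \<open>bij\<close>, while \<open>b\<close> stays outside as the
    index of the family.\<close>
  then show ?thesis
    by (simp only: bij_iff) (rule all_comm)
qed

lemma orthogonal_iff_bij_right:
  assumes "\<And>x y b. B x y = b \<longleftrightarrow> y = k b x"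
  shows "orthogonal A B \<longleftrightarrow> (\<forall>b. bij (\<lambda>x. A x (k b x)))"
proof -
  have "(\<exists>!(x, y). A x y = a \<and> B x y = b) \<longleftrightarrow> (\<exists>!x. A x (k b x) = a)" for a b
    unfolding assms Ex1_def split_paired_Ex split_paired_All by fastforce
  then have "orthogonal A B \<longleftrightarrow> (\<forall>a b. \<exists>!x. A x (k b x) = a)"
    by (simp only: orthogonal_def)
  then show ?thesis
    by (simp only: bij_iff) (rule all_comm)
qed

text \<open>Bijections cancel on both sides of a composition. Below, \<open>v\<close> collects the
  outer summands together with an automorphism or an inversion, and \<open>u\<close> is the
  substitution.\<close>

lemma bij_equivalent:
  assumes "bij v" "bij u" and F: "\<And>x. F x = v (G (u x))"
  shows "bij F \<longleftrightarrow> bij G"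
proof
  have "G = inv v \<circ> F \<circ> inv u"
    using assms by (auto simp: fun_eq_iff bij_def surj_f_inv_f)
  moreover assume "bij F"
  ultimately show "bij G"
    using assms by (simp add: bij_comp bij_imp_bij_inv)
next
  have "F = v \<circ> G \<circ> u" by (simp add: fun_eq_iff F)
  moreover assume "bij G"
  ultimately show "bij F"
    using assms by (simp add: bij_comp)
qed

lemma bij_add_add: "bij (\<lambda>x. p + x + q :: 'a::group_add)"
  by (rule bij_betw_byWitness[where f' = "\<lambda>x. - p + x - q"]) (auto simp: add.assoc diff_conv_add_uminus
    simp del: add_uminus_conv_diff)

lemma bij_add_minus_add: "bij (\<lambda>x. p + - x + q :: 'a::group_add)"
  \<comment> \<open>The witness solves \<open>z = p + - x + q\<close> for \<open>x\<close>;
    inverting \<open>- x\<close> swaps the sides of \<open>p\<close> and \<open>q\<close>.\<close>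
  by (rule bij_betw_byWitness[where f' = "\<lambda>x. q + - x + p"]) (auto simp: add.assoc minus_add
    simp del: add_uminus_conv_diff)

lemma group_automorphism_simps:
  assumes "group_automorphism f"
  shows "f (x + y) = f x + f y" "f 0 = 0" "f (- x) = - f x" "f (x - y) = f x + - f y"
    "inv f (f x) = x" "f (inv f x) = x"
proof -
  show add: "f (x + y) = f x + f y" for x y
    using assms by (simp add: group_automorphism_def)
  show zero: "f 0 = 0"
    using add[of 0 0] add_left_cancel[of "f 0" "f 0" 0] by simp
  show minus: "f (- x) = - f x" for x
    using add[of "- x" x] zero by (simp add: eq_neg_iff_add_eq_0)
  show "f (x - y) = f x + - f y"
    using add[of x "- y"] minus by simp
  show "inv f (f x) = x" "f (inv f x) = x"
    using assms by (auto simp: group_automorphism_def bij_def surj_f_inv_f)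
qed

lemma group_automorphism_inv:
  assumes "group_automorphism f"
  shows "group_automorphism (inv f)"
  unfolding group_automorphism_def
proof (intro conjI allI)
  show "bij (inv f)"
    using assms by (simp add: group_automorphism_def bij_imp_bij_inv)
  show "inv f (x + y) = inv f x + inv f y" for x y
    by (metis group_automorphism_simps(1,5,6)[OF assms])
qed

text \<open>Reindexing: every \<open>t\<close> is some \<open>\<sigma> b\<close>, so injectivity of
  \<open>\<sigma>\<close> is irrelevant.\<close>

lemma all_bij_cong:
  assumes "surj \<sigma>" and "\<And>b. bij (F b) \<longleftrightarrow> bij (G (\<sigma> b))"
  shows "(\<forall>b. bij (F b)) \<longleftrightarrow> (\<forall>t. bij (G t))"
  using assms by (metis surjD)

locale alinear_quasigroup =
  fixes \<phi> \<psi> :: "'q::group_add \<Rightarrow> 'q" and c :: 'q and A :: "'q \<Rightarrow> 'q \<Rightarrow> 'q"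
  assumes \<phi>: "group_automorphism \<phi>" and \<psi>: "group_automorphism \<psi>"
    and A: "A x y = - \<phi> x + - \<psi> y + c"
begin

lemma quasigroup_A: "quasigroup A"
proof -
  have "A = (\<lambda>x y. - \<phi> x + - \<psi> y + c)" by (simp only: A fun_eq_iff) simp
  then show ?thesis using quasigroup_alinear[OF \<phi> \<psi>] by simp
qed

lemmas hom_simps = group_automorphism_simps[OF \<phi>] group_automorphism_simps[OF \<psi>]
  group_automorphism_simps(1-4)[OF group_automorphism_inv[OF \<phi>]]
  group_automorphism_simps(1-4)[OF group_automorphism_inv[OF \<psi>]]

text \<open>Writes each term as a right-nested sum of signed images of variables, in which only
  neighbours can cancel. The rule \<open>add_uminus_conv_diff\<close> would restore differences and
  is therefore deleted wherever this set is used.\<close>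

lemmas normal_form = A J_def hom_simps add.assoc diff_conv_add_uminus minus_add

lemma bij_\<phi>: "bij \<phi>" and bij_\<psi>: "bij \<psi>"
  using \<phi> \<psi> by (simp_all add: group_automorphism_def)

lemma orthogonal_par_12_iff:
  "orthogonal A (par_12 A) \<longleftrightarrow> (\<forall>t. bij (\<lambda>x. inv \<psi> (\<phi> x) - J t (inv \<phi> (\<psi> x))))"
proof -
  let ?k = "\<lambda>b x. inv \<phi> (- \<psi> x + c - b)"
  have "par_12 A x y = b \<longleftrightarrow> y = ?k b x" for x y b
  proof -
    have "A y x = b \<longleftrightarrow> \<phi> y = - \<psi> x + c - b"
      unfolding A by (metis add.assoc add_minus_cancel minus_add_cancel diff_add_cancel
          add_diff_cancel minus_minus)
    also have "\<dots> \<longleftrightarrow> y = ?k b x"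
      by (metis hom_simps(5,6))
    finally show ?thesis by (simp only: par_12_def)
  qed
  then have "orthogonal A (par_12 A) \<longleftrightarrow> (\<forall>b. bij (\<lambda>x. A x (?k b x)))"
    by (rule orthogonal_iff_bij_right)
  also have "\<dots> \<longleftrightarrow> (\<forall>t. bij (\<lambda>x. inv \<psi> (\<phi> x) - J t (inv \<phi> (\<psi> x))))"
  proof (rule all_bij_cong)
    \<comment> \<open>Expanding \<open>A x (?k b x)\<close> gives the middle summand
      \<open>\<psi> (inv \<phi> (b - c))\<close>, which must be \<open>\<psi> t\<close>. The
      constant \<open>?q\<close> then cancels the final \<open>- \<psi> t\<close> coming from
      \<open>J t\<close> and appends \<open>c\<close>.\<close>
    let ?\<sigma> = "\<lambda>b. inv \<phi> (b - c)"
    show "surj ?\<sigma>"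
      by (rule surjI[where f = "\<lambda>t. \<phi> t + c"]) (simp add: normal_form del: add_uminus_conv_diff)
    fix b
    let ?G = "\<lambda>x. inv \<psi> (\<phi> x) - J (?\<sigma> b) (inv \<phi> (\<psi> x))"
    let ?q = "\<psi> (?\<sigma> b) + c"
    show "bij (\<lambda>x. A x (?k b x)) \<longleftrightarrow> bij ?G"
    proof (rule bij_equivalent[where u = uminus])
      show "bij (\<lambda>z. \<psi> z + ?q)"
        using bij_comp[OF bij_\<psi> bij_add_add[of 0 ?q]] by (simp add: comp_def)
      show "A x (?k b x) = \<psi> (?G (- x)) + ?q" for x
        by (simp add: normal_form del: add_uminus_conv_diff)
    qed (rule bij_uminus)
  qed
  finally show ?thesis .
qed

text \<open>Since \<open>par_13 A x y = b\<close> says \<open>A b y = x\<close>, the solution for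
  \<open>x\<close> is a value of \<open>A\<close> itself. The same happens in the remaining three
  parts.\<close>

lemma orthogonal_par_13_iff:
  "orthogonal A (par_13 A) \<longleftrightarrow> (\<forall>t. bij (\<lambda>x. \<phi> x - J (\<psi> t) (J c x)))"
proof -
  have "orthogonal A (par_13 A) \<longleftrightarrow> (\<forall>b. bij (\<lambda>y. A (A b y) y))"
    by (rule orthogonal_iff_bij_left) (metis par_13_iff[OF quasigroup_A])
  also have "\<dots> \<longleftrightarrow> (\<forall>t. bij (\<lambda>x. \<phi> x - J (\<psi> t) (J c x)))"
  proof (rule all_bij_cong)
    \<comment> \<open>The middle summand of \<open>A (A b y) y\<close> is
      \<open>\<phi> (\<phi> b)\<close>, that of \<open>?G\<close> is \<open>\<psi> t + c\<close>;
      equating them determines \<open>t\<close>.\<close>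
    let ?\<sigma> = "\<lambda>b. inv \<psi> (\<phi> (\<phi> b) - c)"
    show "surj ?\<sigma>"
      by (rule surjI[where f = "\<lambda>t. inv \<phi> (inv \<phi> (\<psi> t + c))"])
        (simp add: normal_form del: add_uminus_conv_diff)
    fix b
    let ?G = "\<lambda>x. \<phi> x - J (\<psi> (?\<sigma> b)) (J c x)"
    show "bij (\<lambda>y. A (A b y) y) \<longleftrightarrow> bij ?G"
    proof (rule bij_equivalent[OF bij_add_add bij_\<psi>])
      show "A (A b y) y = - \<phi> c + ?G (\<psi> y) + (\<phi> (\<phi> b) + c)" for y
        by (simp add: normal_form del: add_uminus_conv_diff)
    qed
  qed
  finally show ?thesis .
qed

lemma orthogonal_par_23_iff:
  "orthogonal A (par_23 A) \<longleftrightarrow> (\<forall>t. bij (\<lambda>x. x + - \<psi> (J t x)))"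
proof -
  have "orthogonal A (par_23 A) \<longleftrightarrow> (\<forall>b. bij (\<lambda>x. A x (A x b)))"
    by (rule orthogonal_iff_bij_right) (metis par_23_iff[OF quasigroup_A])
  also have "\<dots> \<longleftrightarrow> (\<forall>t. bij (\<lambda>x. x + - \<psi> (J t x)))"
  proof (rule all_bij_cong)
    \<comment> \<open>The middle summand of \<open>A x (A x b)\<close> is
      \<open>- \<psi> c + \<psi> (\<psi> b)\<close>, which is \<open>\<psi> t\<close> for this
      \<open>t\<close>.\<close>
    let ?\<sigma> = "\<lambda>b. - c + \<psi> b"
    show "surj ?\<sigma>"
      by (rule surjI[where f = "\<lambda>t. inv \<psi> (c + t)"]) (simp add: normal_form del: add_uminus_conv_diff)
    fix b
    let ?G = "\<lambda>x. x + - \<psi> (J (?\<sigma> b) x)"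
    show "bij (\<lambda>x. A x (A x b)) \<longleftrightarrow> bij ?G"
    proof (rule bij_equivalent[OF bij_add_add])
      show "bij (\<lambda>x. - \<phi> x)"
        using bij_comp[OF bij_\<phi> bij_uminus] by (simp add: comp_def)
      show "A x (A x b) = 0 + ?G (- \<phi> x) + (\<psi> (?\<sigma> b) + c)" for x
        by (simp add: normal_form del: add_uminus_conv_diff)
    qed
  qed
  finally show ?thesis .
qed

text \<open>In \<open>A x (A b x)\<close> the term in \<open>\<phi>\<close> precedes the one in
  \<open>\<psi> \<circ> \<psi>\<close>, opposite to \<open>?G\<close>; the inversion in the outer
  map reverses the order.\<close>

lemma orthogonal_par_123_iff:
  "orthogonal A (par_123 A) \<longleftrightarrow> bij (\<lambda>x. \<psi> (\<psi> x) - \<phi> (J (inv \<psi> c) x))"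
    (is "_ \<longleftrightarrow> bij ?G")
proof -
  have "orthogonal A (par_123 A) \<longleftrightarrow> (\<forall>b. bij (\<lambda>x. A x (A b x)))"
    by (rule orthogonal_iff_bij_right) (metis par_123_iff[OF quasigroup_A])
  also have "\<dots> \<longleftrightarrow> bij ?G"
  proof -
    let ?e = "inv \<psi> c"
    have "bij (\<lambda>x. A x (A b x)) \<longleftrightarrow> bij ?G" for b
    proof (rule bij_equivalent[OF bij_add_minus_add bij_add_minus_add])
      \<comment> \<open>The shift by \<open>?e\<close> turns the middle summand \<open>\<phi> ?e\<close> of \<open>?G\<close> into \<open>\<psi> (\<psi> ?e) = \<psi> c\<close>.\<close>
      show "A x (A b x) = - \<phi> ?e + - ?G (0 + - x + ?e) + (\<psi> (\<phi> b) + c)" for x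
        by (simp add: normal_form del: add_uminus_conv_diff)
    qed
    then show ?thesis by simp
  qed
  finally show ?thesis .
qed

lemma orthogonal_par_132_iff:
  "orthogonal A (par_132 A) \<longleftrightarrow> bij (\<lambda>x. \<psi> x - \<phi> (\<phi> x))" (is "_ \<longleftrightarrow> bij ?G")
proof -
  have "orthogonal A (par_132 A) \<longleftrightarrow> (\<forall>b. bij (\<lambda>y. A (A y b) y))"
    by (rule orthogonal_iff_bij_left) (metis par_132_iff[OF quasigroup_A])
  also have "\<dots> \<longleftrightarrow> bij ?G"
  proof -
    have "bij (\<lambda>y. A (A y b) y) \<longleftrightarrow> bij ?G" for b
    proof (rule bij_equivalent[OF bij_add_minus_add bij_id])
      show "A (A y b) y = (- \<phi> c + \<phi> (\<psi> b)) + - ?G (id y) + c" for y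
        by (simp add: normal_form del: add_uminus_conv_diff)
    qed
    then show ?thesis by simp
  qed
  finally show ?thesis .
qed

end

theorem theorem51:
  fixes \<phi> \<psi> :: "'q::group_add \<Rightarrow> 'q" and c :: 'q and A :: "'q \<Rightarrow> 'q \<Rightarrow> 'q"
  assumes "group_automorphism \<phi>" and "group_automorphism \<psi>"
    and "\<And>x y. A x y = - \<phi> x + - \<psi> y + c"
  shows "(orthogonal A (par_12 A) \<longleftrightarrow> (\<forall>t. bij (\<lambda>x. inv \<psi> (\<phi> x) - J t (inv \<phi> (\<psi> x))))) \<and>
    (orthogonal A (par_13 A) \<longleftrightarrow> (\<forall>t. bij (\<lambda>x. \<phi> x - J (\<psi> t) (J c x)))) \<and>
    (orthogonal A (par_23 A) \<longleftrightarrow> (\<forall>t. bij (\<lambda>x. x + - \<psi> (J t x)))) \<and>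
    (orthogonal A (par_123 A) \<longleftrightarrow> bij (\<lambda>x. \<psi> (\<psi> x) - \<phi> (J (inv \<psi> c) x))) \<and>
    (orthogonal A (par_132 A) \<longleftrightarrow> bij (\<lambda>x. \<psi> x - \<phi> (\<phi> x)))"
proof -
  interpret alinear_quasigroup \<phi> \<psi> c A
    by unfold_locales (fact assms)+
  show ?thesis
    by (intro conjI orthogonal_par_12_iff orthogonal_par_13_iff orthogonal_par_23_iff
        orthogonal_par_123_iff orthogonal_par_132_iff)
qed

end
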